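(* Let $E$ be a path-connected space and let $F\to E\times E\xrightarrow{q}Y$ be a fibration with $Y$ path-connected, where $F=q^{-1}(b)\subseteq E\times E$ is the fibre over a base-point $b\in Y$. Then \[ \mathsf{TC}(E)\leq \mathsf{cat}(Y)\cdot\mathsf{TC}_E(F). \] In particular, if $F\to E\xrightarrow{p}B$ is a fibration with $B$ path-connected, where now $F=p^{-1}(b)\subseteq E$ is the fibre over a base-point $b\in B$, then, applying this to the product fibration $F\times F\to E\times E\xrightarrow{p\times p}B\times B$, \[ \mathsf{TC}(E)\leq \mathsf{cat}(B\times B)\cdot\mathsf{TC}_E(F\times F). \]
   Context: Fibrations are Hurewicz fibrations. For a path-connected space $X$, let $\mathscr{P}X=\{\gamma\colon [0,1]\to X\}$ be the space of continuous paths in $X$ with the compact-open topology, and let $\pi\colon\mathscr{P}X\to X\times X$, $\pi(\gamma)=(\gamma(0),\gamma(1))$. For a subspace $A\subseteq X\times X$, the subspace topological complexity $\mathsf{TC}_X(A)$ is the smallest integer $k\ge 0$ such that $A$ can be covered by $k$ sets $U_1,\dots,U_k$, open in $A$, each admitting a continuous map $s_i\colon U_i\to\mathscr{P}X$ with $\pi\circ s_i$ equal to the inclusion $U_i\hookrightarrow X\times X$; it is $\infty$ if no such integer exists. The topological complexity is $\mathsf{TC}(X)=\mathsf{TC}_X(X\times X)$ (not reduced: $\mathsf{TC}(\text{point})=1$). For a path-connected space $X$, the Lusternik–Schnirelmann category $\mathsf{cat}(X)$ is the smallest integer $k$ such that $X$ has an open cover $X=U_1\cup\dots\cup U_k$ with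 each inclusion $U_j\hookrightarrow X$ null-homotopic, and $\infty$ if no such integer exists (not reduced: $\mathsf{cat}(\text{point})=1$). *)

theory Defs
  imports "HOL-Analysis.Analysis" "HOL-Library.Extended_Nat"
begin

section \<open>Path spaces with the compact-open topology\<close>

abbreviation unit_interval :: "real topology" where
  "unit_interval \<equiv> top_of_set {0..1}"

(* Maps defined on topspace X only are represented by functions in extensional (topspace X),
   so that each map has exactly one representative. The subbasic sets with K = {} show that
   every such map is a point of the space. *)
definition compact_open :: "'a topology \<Rightarrow> 'b topology \<Rightarrow> ('a \<Rightarrow> 'b) topology" where
  "compact_open X Y = topology_generated_by
     {{f \<in> extensional (topspace X). continuous_map X Y f \<and> f ` K \<subseteq> U} | K U.
        compactin X K \<and> openin Y U}"

definition path_space :: "'a topology \<Rightarrow> (real \<Rightarrow> 'a) topology" where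
  "path_space X = compact_open unit_interval X"

definition endpoints :: "(real \<Rightarrow> 'a) \<Rightarrow> 'a \<times> 'a" where
  "endpoints \<gamma> = (\<gamma> 0, \<gamma> 1)"


section \<open>Topological complexity and Lusternik--Schnirelmann category\<close>

definition has_motion_planner :: "'a topology \<Rightarrow> ('a \<times> 'a) set \<Rightarrow> bool" where
  "has_motion_planner X U \<longleftrightarrow>
     (\<exists>s. continuous_map (subtopology (prod_topology X X) U) (path_space X) s \<and>
          (\<forall>z\<in>U. endpoints (s z) = z))"

(* The infimum of the empty set of extended naturals is infinity. *)
definition subspace_TC :: "'a topology \<Rightarrow> ('a \<times> 'a) set \<Rightarrow> enat" where
  "subspace_TC X A =
     (INF k \<in> {k::nat. \<exists>U. (\<forall>i<k. openin (subtopology (prod_topology X X) A) (U i) \<and>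
                                  has_motion_planner X (U i)) \<and>
                          A = (\<Union>i<k. U i)}. enat k)"

definition TC :: "'a topology \<Rightarrow> enat" where
  "TC X = subspace_TC X (topspace X \<times> topspace X)"

definition LS_cat :: "'a topology \<Rightarrow> enat" where
  "LS_cat X =
     (INF k \<in> {k::nat. \<exists>U. (\<forall>i<k. openin X (U i) \<and>
                              (\<exists>c. homotopic_with (\<lambda>h. True) (subtopology X (U i)) X
                                     id (\<lambda>x. c))) \<and>
                          topspace X = (\<Union>i<k. U i)}. enat k)"


section \<open>Hurewicz fibrations\<close>

definition homotopy_lifting_property ::
    "'z topology \<Rightarrow> 'e topology \<Rightarrow> 'b topology \<Rightarrow> ('e \<Rightarrow> 'b) \<Rightarrow> bool" where
  "homotopy_lifting_property Z E B p \<longleftrightarrow>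
     (\<forall>f H. continuous_map Z E f \<and>
            continuous_map (prod_topology Z unit_interval) B H \<and>
            (\<forall>z\<in>topspace Z. H (z, 0) = p (f z)) \<longrightarrow>
        (\<exists>G. continuous_map (prod_topology Z unit_interval) E G \<and>
             (\<forall>z\<in>topspace Z. G (z, 0) = f z) \<and>
             (\<forall>z\<in>topspace Z. \<forall>t\<in>{0..1}. p (G (z, t)) = H (z, t))))"

(* A Hurewicz fibration has the homotopy lifting property for all spaces Z. A definition cannot
   quantify over all types, so Z ranges over all spaces on one type; that type is large enough
   for the property to follow for spaces on every type, which is shown below in
   hurewicz_fibration_homotopy_lifting. *)
definition hurewicz_fibration :: "'e topology \<Rightarrow> 'b topology \<Rightarrow> ('e \<Rightarrow> 'b) \<Rightarrow> bool" where
  "hurewicz_fibration E B p \<longleftrightarrow>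
     continuous_map E B p \<and>
     (\<forall>Z :: ('e \<times> (real \<Rightarrow> 'b)) topology. homotopy_lifting_property Z E B p)"

definition fibre :: "'e topology \<Rightarrow> ('e \<Rightarrow> 'b) \<Rightarrow> 'b \<Rightarrow> 'e set" where
  "fibre E p b = {e \<in> topspace E. p e = b}"


section \<open>The homotopy lifting property for spaces on arbitrary types\<close>

lemma topspace_compact_open:
  "topspace (compact_open X Y) = {f \<in> extensional (topspace X). continuous_map X Y f}"
proof -
  have "{f \<in> extensional (topspace X). continuous_map X Y f} \<in>
      {{f \<in> extensional (topspace X). continuous_map X Y f \<and> f ` K \<subseteq> U} | K U.
        compactin X K \<and> openin Y U}"
    by (intro CollectI exI[of _ "{}"]) auto
  then show ?thesis
    unfolding compact_open_def topology_generated_by_topspace by blast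
qed

lemma openin_compact_open_subbasic:
  assumes "compactin X K" "openin Y U"
  shows "openin (compact_open X Y)
           {f \<in> extensional (topspace X). continuous_map X Y f \<and> f ` K \<subseteq> U}"
  unfolding compact_open_def by (rule topology_generated_by_Basis) (use assms in blast)

lemma continuous_map_curry:
  assumes H: "continuous_map (prod_topology Z X) Y H"
  shows "continuous_map Z (compact_open X Y) (\<lambda>z. restrict (\<lambda>x. H (z, x)) (topspace X))"
proof -
  let ?h = "\<lambda>z. restrict (\<lambda>x. H (z, x)) (topspace X)"
  have cont: "continuous_map X Y (?h z)" if "z \<in> topspace Z" for z
  proof -
    have "continuous_map X (prod_topology Z X) (\<lambda>x. (z, x))"
      using that by (intro continuous_map_pairedI) auto
    from continuous_map_compose[OF this H] have "continuous_map X Y (\<lambda>x. H (z, x))"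
      by (simp add: o_def)
    then show ?thesis
      by (rule continuous_map_eq) auto
  qed
  have "openin Z (?h -` {f \<in> extensional (topspace X). continuous_map X Y f \<and> f ` K \<subseteq> U}
                   \<inter> topspace Z)" (is "openin Z ?P")
    if K: "compactin X K" and U: "openin Y U" for K U
  proof (subst openin_subopen, intro ballI)
    fix z assume z: "z \<in> ?P"
    let ?W = "{w \<in> topspace (prod_topology Z X). H w \<in> U}"
    have KX: "K \<subseteq> topspace X"
      using K by (rule compactin_subset_topspace)
    have W: "openin (prod_topology Z X) ?W"
      using H U by (rule openin_continuous_map_preimage)
    have "H (z, x) \<in> U" if "x \<in> K" for x
      using z KX that by (force simp: image_subset_iff)
    then have "{z} \<times> K \<subseteq> ?W"
      using z KX by auto
    then obtain M V where
      M: "openin Z M" "K \<subseteq> V" "z \<in> M" "M \<times> V \<subseteq> ?W"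
      using tube_lemma_right[OF W K, of z] z by blast
    have "M \<subseteq> ?P"
    proof
      fix m assume m: "m \<in> M"
      have mZ: "m \<in> topspace Z"
        using m M(1) openin_subset by blast
      have "?h m ` K \<subseteq> U"
        using m M(2,4) KX by force
      then show "m \<in> ?P"
        using cont[OF mZ] mZ by auto
    qed
    with M show "\<exists>T. openin Z T \<and> z \<in> T \<and> T \<subseteq> ?P" by blast
  qed
  moreover have "?h ` topspace Z \<subseteq> topspace (compact_open X Y)"
    using cont by (auto simp: topspace_compact_open)
  ultimately show ?thesis
    unfolding compact_open_def continuous_on_generated_topo_iff topology_generated_by_topspace
    by auto
qed

lemma continuous_map_path_eval:
  fixes X :: "'a topology"
  shows "continuous_map (prod_topology (path_space X) unit_interval) X (\<lambda>(\<gamma>, t). \<gamma> t)"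
proof -
  let ?C = "{\<gamma> \<in> extensional {0..1}. continuous_map unit_interval X \<gamma>}"
  have top: "topspace (path_space X) = ?C"
    by (simp add: path_space_def topspace_compact_open)
  let ?PI = "prod_topology (path_space X) unit_interval"
  have opn: "openin (prod_topology (path_space X) unit_interval)
          {w \<in> ?C \<times> {0..1}. (case w of (\<gamma>, t) \<Rightarrow> \<gamma> t) \<in> U}" (is "openin _ ?P")
    if U: "openin X U" for U
  proof (subst openin_subopen, intro ballI)
    fix w assume "w \<in> ?P"
    then obtain \<gamma> t where w: "w = (\<gamma>, t)" and \<gamma>: "\<gamma> \<in> ?C" and t: "t \<in> {0..1}" and \<gamma>t: "\<gamma> t \<in> U"
      by auto
    have "openin unit_interval {s \<in> topspace unit_interval. \<gamma> s \<in> U}"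
      using \<gamma> U by (intro openin_continuous_map_preimage) auto
    then obtain O' where O': "open O'" "{s \<in> {0..1}. \<gamma> s \<in> U} = {0..1} \<inter> O'"
      by (auto simp: openin_open)
    with t \<gamma>t have "t \<in> O'" by auto
    with O'(1) obtain e where e: "e > 0" "cball t e \<subseteq> O'"
      by (meson open_contains_cball)
    let ?K = "{0..1} \<inter> cball t e"
    let ?N = "{f \<in> extensional (topspace unit_interval).
                 continuous_map unit_interval X f \<and> f ` ?K \<subseteq> U}"
    have K: "compactin unit_interval ?K"
      by (simp add: compactin_subtopology compact_Int)
    have N: "openin (path_space X) ?N"
      unfolding path_space_def using K U by (rule openin_compact_open_subbasic)
    have B: "openin unit_interval ({0..1} \<inter> ball t e)"
      by (simp add: openin_open_Int)
    have "openin ?PI (?N \<times> ({0..1} \<inter> ball t e))"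
      using N B by (simp add: openin_prod_Times_iff)
    moreover have "\<gamma> ` ?K \<subseteq> U"
      using O'(2) e(2) by blast
    then have "w \<in> ?N \<times> ({0..1} \<inter> ball t e)"
      using w \<gamma> t e(1) by simp
    moreover have "?N \<times> ({0..1} \<inter> ball t e) \<subseteq> ?P"
      by (auto simp: image_subset_iff)
    ultimately show "\<exists>S. openin ?PI S \<and> w \<in> S \<and> S \<subseteq> ?P" by blast
  qed
  have im: "\<gamma> t \<in> topspace X" if "\<gamma> \<in> ?C" "t \<in> {0..1}" for \<gamma> t
    using that by (auto simp: continuous_map_def)
  have T: "topspace ?PI = ?C \<times> {0..1}"
    by (simp add: top)
  show ?thesis
    unfolding continuous_map_def[of ?PI] T
  proof (intro conjI allI impI funcsetI)
    fix w :: "(real \<Rightarrow> 'a) \<times> real"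
    assume "w \<in> ?C \<times> {0..1}"
    then obtain \<gamma> t where w: "w = (\<gamma>, t)" and \<gamma>t: "\<gamma> \<in> ?C" "t \<in> {0..1}"
      by (elim SigmaE)
    show "(case w of (\<gamma>, t) \<Rightarrow> \<gamma> t) \<in> topspace X"
      unfolding w prod.case by (rule im[OF \<gamma>t])
  qed (rule opn)
qed

theorem hurewicz_fibration_homotopy_lifting:
  fixes Z :: "'z topology" and E :: "'e topology" and B :: "'b topology"
  assumes "hurewicz_fibration E B p"
  shows "homotopy_lifting_property Z E B p"
  unfolding homotopy_lifting_property_def
proof (intro allI impI, elim conjE)
  fix f H
  assume f: "continuous_map Z E f"
    and H: "continuous_map (prod_topology Z unit_interval) B H"
    and fH: "\<forall>z\<in>topspace Z. H (z, 0) = p (f z)"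
  let ?W = "subtopology (prod_topology E (path_space B)) {w. snd w 0 = p (fst w)}"
  let ?ev = "\<lambda>(w :: 'e \<times> (real \<Rightarrow> 'b), t). snd w t"
  have fst: "continuous_map ?W E fst"
    by (simp add: continuous_map_from_subtopology continuous_map_fst)
  have "continuous_map (prod_topology ?W unit_interval) (prod_topology (path_space B) unit_interval)
          (\<lambda>x. (snd (fst x), snd x))"
  proof (rule continuous_map_pairedI)
    have "continuous_map ?W (path_space B) snd"
      by (simp add: continuous_map_from_subtopology continuous_map_snd)
    from continuous_map_compose[OF continuous_map_fst this]
    show "continuous_map (prod_topology ?W unit_interval) (path_space B) (\<lambda>x. snd (fst x))"
      by (simp add: o_def)
  qed (rule continuous_map_snd)
  from continuous_map_compose[OF this continuous_map_path_eval]
  have ev: "continuous_map (prod_topology ?W unit_interval) B ?ev"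
    by (simp add: o_def case_prod_unfold)
  have "homotopy_lifting_property ?W E B p"
    using assms by (simp add: hurewicz_fibration_def)
  then have "continuous_map ?W E fst \<and> continuous_map (prod_topology ?W unit_interval) B ?ev \<and>
      (\<forall>w\<in>topspace ?W. ?ev (w, 0) = p (fst w)) \<longrightarrow>
      (\<exists>G. continuous_map (prod_topology ?W unit_interval) E G \<and>
           (\<forall>w\<in>topspace ?W. G (w, 0) = fst w) \<and>
           (\<forall>w\<in>topspace ?W. \<forall>t\<in>{0..1}. p (G (w, t)) = ?ev (w, t)))"
    unfolding homotopy_lifting_property_def by (drule_tac x = fst in spec) (drule_tac x = ?ev in spec)
  moreover have "\<forall>w\<in>topspace ?W. ?ev (w, 0) = p (fst w)"
    by simp
  ultimately have "\<exists>G. continuous_map (prod_topology ?W unit_interval) E G \<and>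
           (\<forall>w\<in>topspace ?W. G (w, 0) = fst w) \<and>
           (\<forall>w\<in>topspace ?W. \<forall>t\<in>{0..1}. p (G (w, t)) = ?ev (w, t))"
    using fst ev by blast
  then obtain G where G: "continuous_map (prod_topology ?W unit_interval) E G"
    "\<And>w. w \<in> topspace ?W \<Longrightarrow> G (w, 0) = fst w"
    "\<And>w t. w \<in> topspace ?W \<Longrightarrow> t \<in> {0..1} \<Longrightarrow> p (G (w, t)) = snd w t"
    unfolding prod.case by blast
  let ?\<phi> = "\<lambda>z. (f z, restrict (\<lambda>t. H (z, t)) {0..1})"
  have "continuous_map Z (path_space B) (\<lambda>z. restrict (\<lambda>t. H (z, t)) {0..1})"
    using continuous_map_curry[OF H] by (simp add: path_space_def)
  then have \<phi>: "continuous_map Z ?W ?\<phi>"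
    using f fH by (auto simp: continuous_map_in_subtopology intro!: continuous_map_pairedI)
  have \<phi>W: "?\<phi> z \<in> topspace ?W" if "z \<in> topspace Z" for z
    using continuous_map_image_subset_topspace[OF \<phi>] that by blast
  have "continuous_map (prod_topology Z unit_interval) (prod_topology ?W unit_interval)
          (\<lambda>x. (?\<phi> (fst x), snd x))"
  proof (rule continuous_map_pairedI)
    from continuous_map_compose[OF continuous_map_fst \<phi>]
    show "continuous_map (prod_topology Z unit_interval) ?W (\<lambda>x. ?\<phi> (fst x))"
      by (simp add: o_def)
  qed (rule continuous_map_snd)
  from continuous_map_compose[OF this G(1)]
  have "continuous_map (prod_topology Z unit_interval) E (\<lambda>x. G (?\<phi> (fst x), snd x))"
    by (simp add: o_def)
  moreover have "G (?\<phi> z, 0) = f z" if "z \<in> topspace Z" for z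
    using G(2)[OF \<phi>W[OF that]] by simp
  moreover have "p (G (?\<phi> z, t)) = H (z, t)" if "z \<in> topspace Z" "t \<in> {0..1}" for z t
    using G(3)[OF \<phi>W[OF that(1)] that(2)] that(2) by simp
  ultimately show "\<exists>G. continuous_map (prod_topology Z unit_interval) E G \<and>
             (\<forall>z\<in>topspace Z. G (z, 0) = f z) \<and>
             (\<forall>z\<in>topspace Z. \<forall>t\<in>{0..1}. p (G (z, t)) = H (z, t))"
    by (intro exI[of _ "\<lambda>x. G (?\<phi> (fst x), snd x)"]) simp
qed

end

theory Submission
  imports Defs
begin

text \<open>A motion planner on \<open>U\<close> is the same as a homotopy between the two projections
  \<open>U \<rightarrow> E\<close>. If \<open>V \<subseteq> Y\<close> is open and null-homotopic in \<open>Y\<close>, lifting the contraction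
  along \<open>q\<close> deforms the inclusion of \<open>q\<^sup>-\<^sup>1(V)\<close> in \<open>E \<times> E\<close> into a map \<open>g\<close> with values
  in the fibre \<open>F\<close>. On the preimage under \<open>g\<close> of an open subset of \<open>F\<close> with a motion planner
  we obtain \<open>fst \<simeq> fst \<circ> g \<simeq> snd \<circ> g \<simeq> snd\<close>. A categorical cover of \<open>Y\<close> by \<open>m\<close> sets
  and a cover of \<open>F\<close> by \<open>n\<close> sets therefore give a cover of \<open>E \<times> E\<close> by \<open>m * n\<close> sets.\<close>

section \<open>Motion planners as homotopies between the two projections\<close>

text \<open>Evaluation of paths is jointly continuous, so a planner \<open>s\<close> uncurries to
  the homotopy sending \<open>(t, z)\<close> to \<open>s z t\<close>.\<close>

lemma homotopic_fst_snd_if_motion_planner: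
  assumes "has_motion_planner X U"
  shows "homotopic_with (\<lambda>h. True) (subtopology (prod_topology X X) U) X fst snd"
proof -
  let ?S = "subtopology (prod_topology X X) U"
  obtain s where s: "continuous_map ?S (path_space X) s" "\<And>z. z \<in> U \<Longrightarrow> endpoints (s z) = z"
    using assms unfolding has_motion_planner_def by blast
  have "continuous_map (prod_topology unit_interval ?S) (path_space X) (\<lambda>x. s (snd x))"
    using continuous_map_compose[OF continuous_map_snd s(1)] by (simp add: o_def)
  then have "continuous_map (prod_topology unit_interval ?S)
      (prod_topology (path_space X) unit_interval) (\<lambda>x. (s (snd x), fst x))"
    by (intro continuous_map_pairedI continuous_map_fst)
  from continuous_map_compose[OF this continuous_map_path_eval]
  have "continuous_map (prod_topology unit_interval ?S) X (\<lambda>x. s (snd x) (fst x))"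
    by (simp add: o_def)
  moreover have "s z 0 = fst z" "s z 1 = snd z" if "z \<in> topspace ?S" for z
    using s(2)[of z] that by (auto simp: endpoints_def prod_eq_iff)
  ultimately show ?thesis
    \<comment> \<open>The definition of \<open>homotopic_with\<close> fixes the end maps at every
      element of the type; this rewriting requires them only on the topspace, where \<open>s\<close>
      is controlled.\<close>
    by (subst homotopic_with) (auto intro!: exI[of _ "\<lambda>x. s (snd x) (fst x)"])
qed

text \<open>Converse by currying: each point is sent to its track under the homotopy, restricted to
  \<open>{0..1}\<close> so as to be a point of \<open>path_space X\<close>.\<close>

lemma motion_planner_if_homotopic_fst_snd:
  assumes U: "U \<subseteq> topspace (prod_topology X X)"
    and hom: "homotopic_with (\<lambda>h. True) (subtopology (prod_topology X X) U) X fst snd"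
  shows "has_motion_planner X U"
proof -
  let ?S = "subtopology (prod_topology X X) U"
  obtain h where h: "continuous_map (prod_topology unit_interval ?S) X h"
    "\<And>z. h (0, z) = fst z" "\<And>z. h (1, z) = snd z"
    using hom unfolding homotopic_with_def by blast
  have "continuous_map (prod_topology ?S unit_interval) (prod_topology unit_interval ?S)
      (\<lambda>x. (snd x, fst x))"
    by (intro continuous_map_pairedI continuous_map_fst continuous_map_snd)
  from continuous_map_compose[OF this h(1)]
  have "continuous_map (prod_topology ?S unit_interval) X (\<lambda>(z, t). h (t, z))"
    by (simp add: o_def case_prod_unfold)
  from continuous_map_curry[OF this]
  have "continuous_map ?S (path_space X) (\<lambda>z. restrict (\<lambda>t. h (t, z)) {0..1})"
    by (simp add: path_space_def)
  then show ?thesis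
    unfolding has_motion_planner_def
    by (intro exI[of _ "\<lambda>z. restrict (\<lambda>t. h (t, z)) {0..1}"]) (simp add: endpoints_def h)
qed

section \<open>Lifting homotopies, and products of fibrations\<close>

text \<open>Lift the homotopy with start \<open>f\<close>; the map \<open>g\<close> is the time-1
  stage of the lift.\<close>

lemma hurewicz_fibration_lift_homotopic:
  assumes p: "hurewicz_fibration E B p" and f: "continuous_map Z E f"
    and hom: "homotopic_with (\<lambda>h. True) Z B (p \<circ> f) h"
  obtains g where "homotopic_with (\<lambda>h. True) Z E f g" "\<And>z. z \<in> topspace Z \<Longrightarrow> p (g z) = h z"
proof -
  obtain H where H: "continuous_map (prod_topology unit_interval Z) B H"
    "\<And>z. H (0, z) = p (f z)" "\<And>z. H (1, z) = h z"
    using hom unfolding homotopic_with_def by auto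
  \<comment> \<open>Time is the first coordinate in \<open>homotopic_with\<close> but the second in
    \<open>homotopy_lifting_property\<close>.\<close>
  have swap: "continuous_map (prod_topology X X') (prod_topology X' X) (\<lambda>x. (snd x, fst x))"
    for X :: "'x topology" and X' :: "'x' topology"
    by (intro continuous_map_pairedI continuous_map_fst continuous_map_snd)
  have "continuous_map (prod_topology Z unit_interval) B (\<lambda>(z, t). H (t, z))"
    using continuous_map_compose[OF swap H(1)] by (simp add: o_def case_prod_unfold)
  with hurewicz_fibration_homotopy_lifting[OF p, of Z] f H(2)
  obtain G where G: "continuous_map (prod_topology Z unit_interval) E G"
    "\<And>z. z \<in> topspace Z \<Longrightarrow> G (z, 0) = f z"
    "\<And>z t. z \<in> topspace Z \<Longrightarrow> t \<in> {0..1} \<Longrightarrow> p (G (z, t)) = H (t, z)"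
    unfolding homotopy_lifting_property_def by (metis (no_types, lifting) case_prod_conv)
  have "continuous_map (prod_topology unit_interval Z) E (\<lambda>x. G (snd x, fst x))"
    using continuous_map_compose[OF swap G(1)] by (simp add: o_def)
  then have "homotopic_with (\<lambda>h. True) Z E f (\<lambda>z. G (z, 1))"
    using G(2) by (subst homotopic_with) (auto intro!: exI[of _ "\<lambda>x. G (snd x, fst x)"])
  moreover have "p (G (z, 1)) = h z" if "z \<in> topspace Z" for z
    using G(3)[OF that, of 1] H(3) by simp
  ultimately show ?thesis by (rule that)
qed

text \<open>Lifts are formed coordinatewise. Here \<open>Z\<close> lives on the type belonging to
  the product, so each factor needs its lifting property for spaces on an arbitrary type.\<close>

lemma hurewicz_fibration_map_prod:
  assumes "hurewicz_fibration E B p" "hurewicz_fibration E' B' p'"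
  shows "hurewicz_fibration (prod_topology E E') (prod_topology B B') (map_prod p p')"
proof -
  have "continuous_map (prod_topology E E') (prod_topology B B') (map_prod p p')"
    using assms by (auto simp: hurewicz_fibration_def map_prod_def continuous_map_prod_top)
  moreover have "homotopy_lifting_property Z (prod_topology E E') (prod_topology B B') (map_prod p p')"
    for Z :: "(('a \<times> 'c) \<times> (real \<Rightarrow> 'b \<times> 'd)) topology"
    unfolding homotopy_lifting_property_def
  proof (intro allI impI, elim conjE)
    fix f H
    assume f: "continuous_map Z (prod_topology E E') f"
      and H: "continuous_map (prod_topology Z unit_interval) (prod_topology B B') H"
      and fH: "\<forall>z\<in>topspace Z. H (z, 0) = map_prod p p' (f z)"
    have "continuous_map Z E (fst \<circ> f)"
      "continuous_map (prod_topology Z unit_interval) B (fst \<circ> H)"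
      using f H by (simp_all add: continuous_map_pairwise)
    moreover have "\<forall>z\<in>topspace Z. (fst \<circ> H) (z, 0) = p ((fst \<circ> f) z)"
      using fH by simp
    ultimately obtain G where G: "continuous_map (prod_topology Z unit_interval) E G"
      "\<forall>z\<in>topspace Z. G (z, 0) = (fst \<circ> f) z"
      "\<forall>z\<in>topspace Z. \<forall>t\<in>{0..1}. p (G (z, t)) = (fst \<circ> H) (z, t)"
      using hurewicz_fibration_homotopy_lifting[OF assms(1), of Z]
      unfolding homotopy_lifting_property_def by blast
    have "continuous_map Z E' (snd \<circ> f)"
      "continuous_map (prod_topology Z unit_interval) B' (snd \<circ> H)"
      using f H by (simp_all add: continuous_map_pairwise)
    moreover have "\<forall>z\<in>topspace Z. (snd \<circ> H) (z, 0) = p' ((snd \<circ> f) z)"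
      using fH by simp
    ultimately obtain G' where G': "continuous_map (prod_topology Z unit_interval) E' G'"
      "\<forall>z\<in>topspace Z. G' (z, 0) = (snd \<circ> f) z"
      "\<forall>z\<in>topspace Z. \<forall>t\<in>{0..1}. p' (G' (z, t)) = (snd \<circ> H) (z, t)"
      using hurewicz_fibration_homotopy_lifting[OF assms(2), of Z]
      unfolding homotopy_lifting_property_def by blast
    have "continuous_map (prod_topology Z unit_interval) (prod_topology E E') (\<lambda>x. (G x, G' x))"
      using G(1) G'(1) by (rule continuous_map_pairedI)
    then show "\<exists>G. continuous_map (prod_topology Z unit_interval) (prod_topology E E') G \<and>
        (\<forall>z\<in>topspace Z. G (z, 0) = f z) \<and>
        (\<forall>z\<in>topspace Z. \<forall>t\<in>{0..1}. map_prod p p' (G (z, t)) = H (z, t))"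
      using G(2,3) G'(2,3) by (intro exI[of _ "\<lambda>x. (G x, G' x)"]) simp
  qed
  ultimately show ?thesis
    by (simp add: hurewicz_fibration_def)
qed

lemma fibre_map_prod:
  "fibre (prod_topology E E') (map_prod p p') (b, b') = fibre E p b \<times> fibre E' p' b'"
  by (auto simp: fibre_def)

section \<open>Finite values of the invariants are attained by covers\<close>

text \<open>A finite infimum excludes the empty set, whose infimum is infinity; well-ordering then
  makes the infimum a minimum.\<close>

lemma Inf_enat_image_eq_enatD:
  assumes "(INF k \<in> S. enat k) = enat n"
  shows "n \<in> S"
proof -
  have "enat ` S \<noteq> {}"
    using assms by (auto simp: top_enat_def)
  then have "(INF k \<in> S. enat k) \<in> enat ` S"
    by (auto simp: Inf_enat_def intro: LeastI)
  with assms show ?thesis by auto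
qed

lemma subspace_TC_le:
  assumes "\<And>i. i < k \<Longrightarrow> openin (subtopology (prod_topology X X) A) (U i)"
    and "\<And>i. i < k \<Longrightarrow> has_motion_planner X (U i)" and "A = (\<Union>i<k. U i)"
  shows "subspace_TC X A \<le> enat k"
  unfolding subspace_TC_def using assms by (intro INF_lower) blast

lemma subspace_TC_eq_enatE:
  assumes "subspace_TC X A = enat k"
  obtains U where "\<And>i. i < k \<Longrightarrow> openin (subtopology (prod_topology X X) A) (U i)"
    "\<And>i. i < k \<Longrightarrow> has_motion_planner X (U i)" "A = (\<Union>i<k. U i)"
  using Inf_enat_image_eq_enatD[OF assms[unfolded subspace_TC_def]] by blast

lemma LS_cat_eq_enatE:
  assumes "LS_cat X = enat k"
  obtains U where "\<And>i. i < k \<Longrightarrow> openin X (U i)"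
    "\<And>i. i < k \<Longrightarrow> \<exists>c. homotopic_with (\<lambda>h. True) (subtopology X (U i)) X id (\<lambda>x. c)"
    "topspace X = (\<Union>i<k. U i)"
  using Inf_enat_image_eq_enatD[OF assms[unfolded LS_cat_def]] by blast

section \<open>Deforming preimages into the fibre and pulling back planners\<close>

text \<open>A path from \<open>c\<close> to \<open>b\<close> moves the constant map to the base
  point over which the fibre is taken.\<close>

lemma homotopic_with_const_path_connected:
  assumes X: "path_connected_space X" and b: "b \<in> topspace X"
    and hom: "homotopic_with (\<lambda>h. True) Z X f (\<lambda>x. c)"
  shows "homotopic_with (\<lambda>h. True) Z X f (\<lambda>x. b)"
proof (cases "topspace Z = {}")
  \<comment> \<open>With \<open>Z\<close> empty, \<open>c\<close> may lie outside \<open>X\<close>,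
    but any two maps agree on \<open>Z\<close>.\<close>
  case True
  then show ?thesis
    by (metis empty_iff hom homotopic_with_eq)
next
  case False
  then have "c \<in> topspace X"
    using homotopic_with_imp_continuous_maps[OF hom] by (auto simp: continuous_map_const)
  then have "homotopic_with (\<lambda>h. True) Z X (\<lambda>x. c) (\<lambda>x. b)"
    using X b by (simp add: homotopic_constant_maps path_connected_space_iff_path_component)
  with hom show ?thesis by (rule homotopic_with_trans)
qed

text \<open>A path from \<open>p e\<close> to \<open>b\<close> is a homotopy on a one-point space;
  its lift starting at \<open>e\<close> ends in the fibre.\<close>

lemma fibre_nonempty:
  assumes p: "hurewicz_fibration E B p" and B: "path_connected_space B" "b \<in> topspace B"
    and E: "topspace E \<noteq> {}"
  shows "fibre E p b \<noteq> {}"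
proof -
  obtain e where e: "e \<in> topspace E" using E by blast
  let ?Z = "discrete_topology {()}"
  have "p e \<in> topspace B"
    using p e by (auto simp: hurewicz_fibration_def continuous_map_def)
  then have "homotopic_with (\<lambda>h. True) ?Z B (\<lambda>x. p e) (\<lambda>x. p e)"
    by simp
  from homotopic_with_const_path_connected[OF B this]
  have "homotopic_with (\<lambda>h. True) ?Z B (p \<circ> (\<lambda>x. e)) (\<lambda>x. b)"
    by (simp add: o_def)
  moreover have "continuous_map ?Z E (\<lambda>x. e)"
    using e by simp
  ultimately obtain g where g: "homotopic_with (\<lambda>h. True) ?Z E (\<lambda>x. e) g"
      "\<And>z. z \<in> topspace ?Z \<Longrightarrow> p (g z) = b"
    using hurewicz_fibration_lift_homotopic[OF p] by metis
  have "g () \<in> topspace E"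
    using homotopic_with_imp_continuous_maps[OF g(1)] by (simp add: continuous_map_def Pi_iff)
  with g(2) show ?thesis
    by (auto simp: fibre_def)
qed

text \<open>Precomposed with \<open>q\<close>, the contraction of \<open>V\<close> becomes a
  homotopy from \<open>q\<close> to the constant \<open>b\<close>, and its lift is started at the
  identity.\<close>

lemma deform_preimage_into_fibre:
  assumes q: "hurewicz_fibration X Y q" and Y: "path_connected_space Y" "b \<in> topspace Y"
    and hom: "homotopic_with (\<lambda>h. True) (subtopology Y V) Y id (\<lambda>x. c)"
  obtains g where
    "homotopic_with (\<lambda>h. True) (subtopology X {x \<in> topspace X. q x \<in> V}) X id g"
    "g ` {x \<in> topspace X. q x \<in> V} \<subseteq> fibre X q b"
proof -
  let ?W = "{x \<in> topspace X. q x \<in> V}"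
  have "continuous_map (subtopology X ?W) (subtopology Y V) q"
    using q by (auto simp: hurewicz_fibration_def continuous_map_in_subtopology
        continuous_map_from_subtopology)
  from homotopic_with_compose_continuous_map_right[OF
      homotopic_with_const_path_connected[OF Y hom] this]
  have "homotopic_with (\<lambda>h. True) (subtopology X ?W) Y (q \<circ> id) (\<lambda>x. b)"
    by (simp add: o_def)
  moreover have "continuous_map (subtopology X ?W) X id"
    by (simp add: continuous_map_from_subtopology)
  ultimately obtain g where g: "homotopic_with (\<lambda>h. True) (subtopology X ?W) X id g"
    "\<And>x. x \<in> topspace (subtopology X ?W) \<Longrightarrow> q (g x) = b"
    using hurewicz_fibration_lift_homotopic[OF q] by blast
  have "g ` ?W \<subseteq> fibre X q b"
    using g(2) homotopic_with_imp_continuous_maps[OF g(1)]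
    by (auto simp: fibre_def continuous_map_def)
  with g(1) show ?thesis by (rule that)
qed

lemma has_motion_planner_preimage:
  assumes g: "homotopic_with (\<lambda>h. True) (subtopology (prod_topology E E) W) (prod_topology E E) id g"
    and planner: "has_motion_planner E V"
    and P: "P \<subseteq> topspace (prod_topology E E) \<inter> W" "g ` P \<subseteq> V"
  shows "has_motion_planner E P"
proof (rule motion_planner_if_homotopic_fst_snd)
  let ?X = "prod_topology E E"
  have "continuous_map (subtopology ?X P) (subtopology ?X W) id"
    using P(1) by (auto simp: continuous_map_in_subtopology)
  from homotopic_with_compose_continuous_map_right[OF g this]
  have hom: "homotopic_with (\<lambda>h. True) (subtopology ?X P) ?X id g"
    by simp
  then have "continuous_map (subtopology ?X P) (subtopology ?X V) g"
    using P homotopic_with_imp_continuous_maps[OF hom] by (auto simp: continuous_map_in_subtopology)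
  \<comment> \<open>The middle link of the chain: the planner's homotopy on \<open>V\<close>, pulled
    back along \<open>g\<close>.\<close>
  from homotopic_with_compose_continuous_map_right[OF
      homotopic_fst_snd_if_motion_planner[OF planner] this]
  have mid: "homotopic_with (\<lambda>h. True) (subtopology ?X P) E (fst \<circ> g) (snd \<circ> g)"
    by simp
  have "homotopic_with (\<lambda>h. True) (subtopology ?X P) E fst (fst \<circ> g)"
    using homotopic_with_compose_continuous_map_left[OF hom continuous_map_fst] by simp
  moreover have "homotopic_with (\<lambda>h. True) (subtopology ?X P) E snd (snd \<circ> g)"
    using homotopic_with_compose_continuous_map_left[OF hom continuous_map_snd] by simp
  ultimately show "homotopic_with (\<lambda>h. True) (subtopology ?X P) E fst snd"
    using mid homotopic_with_trans homotopic_with_symD by metis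
qed (use P in auto)

section \<open>The product inequality\<close>

text \<open>If both factors are finite, covers are combined. If one is infinite, the other must be
  shown nonzero, since zero times infinity is zero in \<open>enat\<close>.\<close>

lemma TC_le_LS_cat_mult_subspace_TC:
  fixes E :: "'e topology" and Y :: "'y topology"
  assumes Y: "path_connected_space Y" "b \<in> topspace Y"
    and q: "hurewicz_fibration (prod_topology E E) Y q"
  shows "TC E \<le> LS_cat Y * subspace_TC E (fibre (prod_topology E E) q b)"
proof -
  let ?X = "prod_topology E E"
  let ?F = "fibre ?X q b"
  consider m n where "LS_cat Y = enat m" "subspace_TC E ?F = enat n"
    | "LS_cat Y = \<infinity>" | "subspace_TC E ?F = \<infinity>"
    by (meson not_enat_eq)
  then show ?thesis
  proof cases
    case 1
    obtain V where V: "\<And>i. i < m \<Longrightarrow> openin Y (V i)"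
      "\<And>i. i < m \<Longrightarrow> \<exists>c. homotopic_with (\<lambda>h. True) (subtopology Y (V i)) Y id (\<lambda>x. c)"
      "topspace Y = (\<Union>i<m. V i)"
      using 1(1) by (rule LS_cat_eq_enatE) blast
    obtain U where U: "\<And>j. j < n \<Longrightarrow> openin (subtopology ?X ?F) (U j)"
      "\<And>j. j < n \<Longrightarrow> has_motion_planner E (U j)" "?F = (\<Union>j<n. U j)"
      using 1(2) by (rule subspace_TC_eq_enatE) blast
    define W where "W i = {x \<in> topspace ?X. q x \<in> V i}" for i
    have cq: "continuous_map ?X Y q"
      using q by (simp add: hurewicz_fibration_def)
    have W: "openin ?X (W i)" if "i < m" for i
      unfolding W_def using cq V(1)[OF that] by (rule openin_continuous_map_preimage)
    have "\<exists>g. homotopic_with (\<lambda>h. True) (subtopology ?X (W i)) ?X id g \<and> g ` W i \<subseteq> ?F"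
      if i: "i < m" for i
    proof -
      obtain c where "homotopic_with (\<lambda>h. True) (subtopology Y (V i)) Y id (\<lambda>x. c)"
        using V(2)[OF i] by blast
      then show ?thesis
        unfolding W_def by (rule deform_preimage_into_fibre[OF q Y]) blast
    qed
    then obtain g where g:
      "\<And>i. i < m \<Longrightarrow> homotopic_with (\<lambda>h. True) (subtopology ?X (W i)) ?X id (g i)"
      "\<And>i. i < m \<Longrightarrow> g i ` W i \<subseteq> ?F"
      by metis
    define P where "P i j = {x \<in> topspace (subtopology ?X (W i)). g i x \<in> U j}" for i j
    have P: "openin ?X (P i j)" "has_motion_planner E (P i j)" if i: "i < m" and j: "j < n" for i j
    proof -
      \<comment> \<open>\<open>U j\<close> is open only in the fibre, so \<open>g i\<close> has to
        be continuous as a map into \<open>?F\<close>.\<close>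
      have "continuous_map (subtopology ?X (W i)) (subtopology ?X ?F) (g i)"
        using homotopic_with_imp_continuous_maps[OF g(1)[OF i]] g(2)[OF i]
        by (auto simp: continuous_map_in_subtopology)
      then have "openin (subtopology ?X (W i)) (P i j)"
        unfolding P_def using U(1)[OF j] by (rule openin_continuous_map_preimage)
      then show "openin ?X (P i j)"
        using W[OF i] openin_trans_full by blast
      show "has_motion_planner E (P i j)"
        using g(1)[OF i] U(2)[OF j] by (rule has_motion_planner_preimage) (auto simp: P_def)
    qed
    \<comment> \<open>The pair \<open>(i, j)\<close> is numbered \<open>j + i * n\<close>;
      \<open>div\<close> and \<open>mod\<close> recover it because \<open>j < n\<close>.\<close>
    have cover: "topspace ?X \<subseteq> (\<Union>k<m * n. P (k div n) (k mod n))"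
    proof
      fix x assume x: "x \<in> topspace ?X"
      then have "q x \<in> topspace Y"
        using cq by (auto simp: continuous_map_def)
      then obtain i where i: "i < m" "x \<in> W i"
        using x V(3) by (auto simp: W_def)
      with g(2) U(3) obtain j where j: "j < n" "g i x \<in> U j"
        by blast
      have "Suc i * n \<le> m * n"
        using i(1) by (intro mult_le_mono1) simp
      then have "j + i * n < m * n"
        using j(1) by simp
      moreover have "x \<in> P ((j + i * n) div n) ((j + i * n) mod n)"
        using x i j by (simp add: P_def)
      ultimately show "x \<in> (\<Union>k<m * n. P (k div n) (k mod n))"
        by blast
    qed
    have idx: "k div n < m" "k mod n < n" if "k < m * n" for k
      using that by (auto simp: less_mult_imp_div_less intro!: mod_less_divisor gr0I)
    have "subspace_TC E (topspace ?X) \<le> enat (m * n)"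
    proof (rule subspace_TC_le)
      show "topspace ?X = (\<Union>k<m * n. P (k div n) (k mod n))"
        using cover by (auto simp: P_def)
    next
      fix k assume k: "k < m * n"
      show "openin (subtopology ?X (topspace ?X)) (P (k div n) (k mod n))"
        unfolding subtopology_topspace using idx[OF k] by (rule P(1))
      show "has_motion_planner E (P (k div n) (k mod n))"
        using idx[OF k] by (rule P(2))
    qed
    then have "TC E \<le> enat (m * n)"
      by (simp add: TC_def)
    with 1 show ?thesis
      by simp
  next
    case 2
    \<comment> \<open>An empty \<open>E\<close> has \<open>TC E = 0\<close> by the empty cover;
      otherwise the fibre is nonempty and needs at least one planner.\<close>
    show ?thesis
    proof (cases "topspace E = {}")
      case True
      then have "TC E \<le> enat 0"
        unfolding TC_def by (intro subspace_TC_le) auto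
      then show ?thesis
        by (simp flip: zero_enat_def)
    next
      case False
      then have "?F \<noteq> {}"
        using fibre_nonempty[OF q Y] by simp
      then have "subspace_TC E ?F \<noteq> 0"
        by (auto simp: zero_enat_def elim!: subspace_TC_eq_enatE)
      with 2 have "LS_cat Y * subspace_TC E ?F = \<infinity>"
        by (simp only: imult_is_infinity simp_thms)
      then show ?thesis
        by simp
    qed
  next
    case 3
    \<comment> \<open>The point \<open>b\<close> of \<open>Y\<close> rules out the empty
      cover.\<close>
    have "LS_cat Y \<noteq> 0"
      using Y(2) by (auto simp: zero_enat_def elim!: LS_cat_eq_enatE)
    with 3 have "LS_cat Y * subspace_TC E ?F = \<infinity>"
      by (simp only: imult_is_infinity simp_thms)
    then show ?thesis
      by simp
  qed
qed

theorem theorem3p1: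
  fixes E :: "'e topology"
  assumes "path_connected_space E"
  shows "(\<forall>(Y :: 'y topology) q b.
            path_connected_space Y \<and> b \<in> topspace Y \<and>
            hurewicz_fibration (prod_topology E E) Y q \<longrightarrow>
            TC E \<le> LS_cat Y * subspace_TC E (fibre (prod_topology E E) q b)) \<and>
         (\<forall>(B :: 'b topology) p b.
            path_connected_space B \<and> b \<in> topspace B \<and>
            hurewicz_fibration E B p \<longrightarrow>
            TC E \<le> LS_cat (prod_topology B B) * subspace_TC E (fibre E p b \<times> fibre E p b))"
proof (intro conjI allI impI; elim conjE)
  fix Y :: "'y topology" and q b
  assume "path_connected_space Y" "b \<in> topspace Y" "hurewicz_fibration (prod_topology E E) Y q"
  then show "TC E \<le> LS_cat Y * subspace_TC E (fibre (prod_topology E E) q b)"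
    by (rule TC_le_LS_cat_mult_subspace_TC)
next
  fix B :: "'b topology" and p b
  assume "path_connected_space B" "b \<in> topspace B" "hurewicz_fibration E B p"
  \<comment> \<open>The first part with \<open>q = map_prod p p\<close> and base point
    \<open>(b, b)\<close>, whose fibre is the product of the fibres.\<close>
  then have "TC E \<le> LS_cat (prod_topology B B) *
      subspace_TC E (fibre (prod_topology E E) (map_prod p p) (b, b))"
    by (intro TC_le_LS_cat_mult_subspace_TC hurewicz_fibration_map_prod)
      (auto simp: path_connected_space_prod_topology)
  then show "TC E \<le> LS_cat (prod_topology B B) * subspace_TC E (fibre E p b \<times> fibre E p b)"
    by (simp add: fibre_map_prod)
qed

end
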